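(* Let $s$ be any clique size. In the batched dynamic network model described in the context, allowing node insertions, node deletions and edge deletions (but not edge insertions other than those incident to inserted nodes), the deterministic $1$-round bandwidth complexity of $\mathsf{BatchedList}(K_s)$ is $O(\log n)$, where $n$ is the current number of nodes. That is, there is a deterministic algorithm in which each node sends each neighbor $O(\log n)$ bits per round, and after the single round of communication following each batch of updates every $s$-clique of the current graph is listed by at least one of its nodes and no set of $s$ nodes that is not an $s$-clique of the current graph is listed.
   Context: Batched dynamic network model: the network is a sequence of graphs $(G_0, G_1, \dots, G_r)$, $G_i=(V_i,E_i)$. All nodes of $G_0$ know its complete topology. $G_i$ is obtained from $G_{i-1}$ by a batch of updates of the allowed types (here: node insertions together with their incident edges, node deletions together with their incident edges, edge deletions) such that every node of $V_i$ is incident to at most $O(1)$ updates; in particular a newly inserted node has only newly inserted incident edges, hence $O(1)$ of them. Each node has a unique ID of $O(\log n)$ bits ($n$ the current number of nodes) and knows the IDs of its current neighbors. Communication is synchronous; each round: (1) the batch of updates occurs and each node learns its new neighbor list; (2) each node sends each of its current neighbors a message of at most $B$ bits (the bandwidth); (3) nodes receive messages and output their lists. Deleted nodes send and list nothing. $K_s$ is the clique on $s$ vertices. $\mathsf{BatchedList}(H)$ is the problem, in this model, that in each round every subgraph of the current graph isomorphic to $H$ is listed (IDs of its nodes output) by at least one of its nodes, and every listed set is such a subgraph. The deterministic $1$-round bandwidth complexity is the minimum $B$ for which a deterministic algorithm has correct output at every node after one round of communication following each batch. *)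

theory Defs
  imports "Graph_Theory.Graph_Theory" "HOL-Library.Landau_Symbols"
begin

text \<open>
  Nodes are identified with their IDs, which are natural numbers. Undirected simple graphs
  are symmetric loop-free arc relations (\<^locale>\<open>pair_graph\<close>).
\<close>

type_synonym network = "nat pair_pre_digraph"

definition nbrs :: "network \<Rightarrow> nat \<Rightarrow> nat set" where
  "nbrs G v = {u. (v, u) \<in> parcs G}"

text \<open>
  One batch turns \<open>G\<close> into \<open>G'\<close> by inserting nodes together with their incident edges, deleting
  nodes together with their incident edges, and deleting edges. Every update incident to a
  surviving or new node \<open>v\<close> (insertion or deletion of a neighbour, deletion of an edge, edges
  that arrive with \<open>v\<close> itself) changes the edges at \<open>v\<close>, so counting the changed edges at \<open>v\<close>
  counts its updates. A node of \<open>G'\<close> that is not a node of \<open>G\<close> is a newly inserted one.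
  An ID that has left the network may be reused in a later batch, by a new node without memory.
\<close>

definition batch :: "nat \<Rightarrow> network \<Rightarrow> network \<Rightarrow> bool" where
  "batch k G G' \<longleftrightarrow>
     (\<forall>(u, v) \<in> parcs G' - parcs G. u \<notin> pverts G \<or> v \<notin> pverts G) \<and>
     (\<forall>v \<in> pverts G'. card (nbrs G' v - nbrs G v) + card (nbrs G v - nbrs G' v) \<le> k)"

text \<open>
  \<open>G 0, \<dots>, G r\<close> with at most \<open>k\<close> updates per node and batch, and with IDs of
  \<open>L n\<close> bits, \<open>n\<close> being the current number of nodes.
\<close>

definition batched_network :: "nat \<Rightarrow> (nat \<Rightarrow> nat) \<Rightarrow> nat \<Rightarrow> (nat \<Rightarrow> network) \<Rightarrow> bool" where
  "batched_network k L r G \<longleftrightarrow>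
     (\<forall>i\<le>r. pair_graph (G i) \<and> (\<forall>v \<in> pverts (G i). v < 2 ^ L (card (pverts (G i))))) \<and>
     (\<forall>i<r. batch k (G i) (G (Suc i)))"

text \<open>
  Everything a node has learnt so far: its ID, the topology of the initial graph if the node
  was present from the start (\<^const>\<open>None\<close> for nodes inserted later), and for every round since
  it joined, most recent round first, the messages received. The domain of such a map is the
  neighbour list of that round. Since a deterministic node may keep its full view, letting it
  act as a function of the view covers all deterministic algorithms.
\<close>

record view =
  node_id :: nat
  initial_topology :: "network option"
  received :: "(nat \<rightharpoonup> bool list) list"

text \<open>
  \<open>send A w N u\<close> is the message sent to \<open>u\<close> by a node whose view before the round is \<open>w\<close> and
  whose neighbours, after the batch, are \<open>N\<close>; \<open>listing A w\<close> is the output of a node whose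
  view at the end of the round is \<open>w\<close>.
\<close>

record algorithm =
  send :: "view \<Rightarrow> nat set \<Rightarrow> nat \<Rightarrow> bool list"
  listing :: "view \<Rightarrow> nat set set"

definition carry_over :: "network \<Rightarrow> (nat \<Rightarrow> view) \<Rightarrow> nat \<Rightarrow> view" where
  "carry_over G W v =
     (if v \<in> pverts G then W v
      else \<lparr>node_id = v, initial_topology = None, received = []\<rparr>)"

definition message :: "algorithm \<Rightarrow> network \<Rightarrow> (nat \<Rightarrow> view) \<Rightarrow> nat \<Rightarrow> nat \<Rightarrow> bool list" where
  "message A G W u v = send A (W u) (nbrs G u) v"

definition exchange :: "algorithm \<Rightarrow> network \<Rightarrow> (nat \<Rightarrow> view) \<Rightarrow> nat \<Rightarrow> view" where
  "exchange A G W v =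
     (W v)\<lparr>received :=
        (\<lambda>u. if u \<in> nbrs G v then Some (message A G W u v) else None) # received (W v)\<rparr>"

text \<open>
  \<open>views A G i v\<close> is the view of \<open>v\<close> after the round that follows batch \<open>i\<close>; it is meaningful
  only for \<open>v\<close> in \<open>G i\<close>.
\<close>

primrec views :: "algorithm \<Rightarrow> (nat \<Rightarrow> network) \<Rightarrow> nat \<Rightarrow> nat \<Rightarrow> view" where
  "views A G 0 = (\<lambda>v. \<lparr>node_id = v, initial_topology = Some (G 0), received = []\<rparr>)"
| "views A G (Suc i) = exchange A (G (Suc i)) (carry_over (G i) (views A G i))"

definition within_bandwidth ::
    "algorithm \<Rightarrow> (nat \<Rightarrow> nat) \<Rightarrow> nat \<Rightarrow> (nat \<Rightarrow> network) \<Rightarrow> bool" where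
  "within_bandwidth A B r G \<longleftrightarrow>
     (\<forall>i<r. \<forall>(u, v) \<in> parcs (G (Suc i)).
        length (message A (G (Suc i)) (carry_over (G i) (views A G i)) u v)
          \<le> B (card (pverts (G (Suc i)))))"

text \<open>Node sets of the (not necessarily induced) subgraphs of \<open>G\<close> that are isomorphic to \<open>H\<close>.\<close>

definition copies :: "'h pair_pre_digraph \<Rightarrow> 'a pair_pre_digraph \<Rightarrow> 'a set set" where
  "copies H G = {pverts S | S :: 'a pair_pre_digraph.
     subgraph (with_proj S) (with_proj G) \<and> digraph_iso (with_proj H) (with_proj S)}"

text \<open>For a complete graph on \<open>s\<close> vertices the copies are exactly the \<open>s\<close>-cliques.\<close>

lemma copies_complete:
  fixes K :: "'k pair_pre_digraph" and G :: "'a pair_pre_digraph"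
  assumes K: "complete_digraph s (with_proj K)" and G: "pair_graph G"
  shows "copies K G = {X. X \<subseteq> pverts G \<and> card X = s \<and>
           (\<forall>u \<in> X. \<forall>v \<in> X. u \<noteq> v \<longrightarrow> (u, v) \<in> parcs G)}"
proof (intro set_eqI iffI)
  interpret G: pair_graph G by (rule G)
  have Kp: "finite (pverts K)" "card (pverts K) = s" "parcs K = {(u,v). u \<in> pverts K \<and> v \<in> pverts K \<and> u \<noteq> v}"
    using K by (auto simp: complete_digraph_pair_def)
  fix X
  { assume "X \<in> copies K G"
    then obtain S f where S: "X = pverts S" "subgraph (with_proj S) (with_proj G)"
      and f: "pre_digraph.digraph_isomorphism (with_proj K) f" "with_proj S = app_iso f (with_proj K)"
      by (auto simp: copies_def digraph_iso_def)
    have X: "X = iso_verts f ` pverts K" using S(1) f(2)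
      by (metis verts_app_iso with_proj_simps(1))
    have inj: "inj_on (iso_verts f) (pverts K)"
      using f(1) by (simp add: pre_digraph.digraph_isomorphism_def)
    have ar: "(iso_verts f a, iso_verts f b) \<in> parcs S" if "(a,b) \<in> parcs K" for a b
    proof -
      have t: "iso_tail f = fst" "iso_head f = snd" "parcs S = iso_arcs f ` parcs K"
        using f(2) by (simp_all add: app_iso_def with_proj_def)
      have "fst (iso_arcs f (a,b)) = iso_verts f a" "snd (iso_arcs f (a,b)) = iso_verts f b"
        using f(1) that by (auto simp: pre_digraph.digraph_isomorphism_def t)
      then have "iso_arcs f (a,b) = (iso_verts f a, iso_verts f b)" by (metis prod.collapse)
      then show ?thesis using that t(3) by (metis imageI)
    qed
    have "parcs S \<subseteq> parcs G" "pverts S \<subseteq> pverts G" using S(2) by (auto simp: subgraph_def)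
    then show "X \<in> {X. X \<subseteq> pverts G \<and> card X = s \<and> (\<forall>u\<in>X. \<forall>v\<in>X. u \<noteq> v \<longrightarrow> (u, v) \<in> parcs G)}"
      using X S(1) inj Kp ar by (auto simp: card_image) blast }
  { assume X: "X \<in> {X. X \<subseteq> pverts G \<and> card X = s \<and> (\<forall>u\<in>X. \<forall>v\<in>X. u \<noteq> v \<longrightarrow> (u, v) \<in> parcs G)}"
    have fX: "finite X" using X G.pair_finite_verts finite_subset by blast
    then obtain g where g: "bij_betw g (pverts K) X"
      using finite_same_card_bij[of "pverts K" X] fX Kp X by auto
    define S where "S = \<lparr>pverts = X, parcs = {(u,v). u \<in> X \<and> v \<in> X \<and> u \<noteq> v}\<rparr>"
    define f where "f = \<lparr>iso_verts = g, iso_arcs = map_prod g g, iso_head = snd, iso_tail = fst\<rparr>"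
    have im: "g ` pverts K = X" and inj: "inj_on g (pverts K)" using g by (auto simp: bij_betw_def)
    have "map_prod g g ` parcs K = parcs S"
    proof (intro set_eqI iffI)
      fix p assume "p \<in> map_prod g g ` parcs K"
      then show "p \<in> parcs S" using inj im by (auto simp: Kp S_def inj_on_def)
    next
      fix p assume "p \<in> parcs S"
      then obtain a b where "p = (g a, g b)" "a \<in> pverts K" "b \<in> pverts K" "a \<noteq> b"
        using im by (auto simp: S_def)
      then show "p \<in> map_prod g g ` parcs K" by (auto simp: Kp intro!: image_eqI[of _ _ "(a,b)"])
    qed
    then have 1: "with_proj S = app_iso f (with_proj K)"
      by (simp add: app_iso_def with_proj_def f_def S_def im)
    have "wf_digraph (with_proj K)" by unfold_locales (auto simp: Kp)
    moreover have "inj_on (map_prod g g) (parcs K)"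
      using inj unfolding Kp by (auto simp: inj_on_def)
    ultimately have 2: "pre_digraph.digraph_isomorphism (with_proj K) f"
      using inj by (auto simp: pre_digraph.digraph_isomorphism_def f_def)
    have "wf_digraph (with_proj S)" by unfold_locales (auto simp: S_def)
    moreover have "wf_digraph (with_proj G)" by unfold_locales
    ultimately have "subgraph (with_proj S) (with_proj G)"
      using X by (auto simp: subgraph_def S_def compatible_def with_proj_def)
    then show "X \<in> copies K G" using 1 2 unfolding copies_def digraph_iso_def
      by (intro CollectI exI[of _ S]) (auto simp: S_def) }
qed

definition lists_correctly ::
    "algorithm \<Rightarrow> 'h pair_pre_digraph \<Rightarrow> nat \<Rightarrow> (nat \<Rightarrow> network) \<Rightarrow> bool" where
  "lists_correctly A H r G \<longleftrightarrow>
     (\<forall>i. 1 \<le> i \<and> i \<le> r \<longrightarrow>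
        (\<forall>S \<in> copies H (G i). \<exists>v \<in> S. S \<in> listing A (views A G i v)) \<and>
        (\<forall>v \<in> pverts (G i). listing A (views A G i v) \<subseteq> copies H (G i)))"

text \<open>
  Some deterministic algorithm solves BatchedList(\<open>H\<close>) in one round per batch with messages of
  at most \<open>B n\<close> bits. It may depend on \<open>H\<close> and on the model parameters \<open>k\<close>, \<open>L\<close>,
  but not on the network.
\<close>

definition batched_list_one_round ::
    "'h pair_pre_digraph \<Rightarrow> nat \<Rightarrow> (nat \<Rightarrow> nat) \<Rightarrow> (nat \<Rightarrow> nat) \<Rightarrow> bool" where
  "batched_list_one_round H k L B \<longleftrightarrow>
     (\<exists>A. \<forall>r G. batched_network k L r G \<longrightarrow>
        within_bandwidth A B r G \<and> lists_correctly A H r G)"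

end

theory Submission
  imports Defs "HOL-Real_Asymp.Real_Asymp"
begin

text \<open>
  Call a neighbour \<open>y\<close> of \<open>u\<close> recent for another neighbour \<open>z\<close> of \<open>u\<close> if the edge \<open>uy\<close> is not
  older than \<open>uz\<close>. In every round \<open>u\<close> tells each neighbour \<open>z\<close> how the set of these \<open>y\<close> has
  changed, which concerns at most \<open>k\<close> neighbours. As every new edge has a new end, an edge \<open>uy\<close>
  of a clique is recent for the oldest node \<open>z\<close> of the clique, so \<open>z\<close> knows all of the clique.

  A neighbour that \<open>u\<close> has just lost may have left the network, and its ID may then be far too
  long for the current number of nodes. It is therefore named by its rank in the set that \<open>u\<close> and
  \<open>z\<close> agreed upon in the round before; that set has at most \<open>n + k\<close> elements.
\<close>

section \<open>Encoding changes of finite sets\<close>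

text \<open>Each binary digit is preceded by the flag \<open>True\<close>, and a final
  \<open>False\<close> marks the end. The code is thus self-delimiting, at twice the binary length
  plus one.\<close>

fun nat_code :: "nat \<Rightarrow> bool list" where
  "nat_code n = (if n = 0 then [False] else True # odd n # nat_code (n div 2))"

declare nat_code.simps [simp del]

lemma nat_code_not_Nil [simp]: "nat_code n \<noteq> []"
  by (subst nat_code.simps) simp

lemma nat_code_append_cancel:
  "nat_code m @ xs = nat_code n @ ys \<Longrightarrow> m = n \<and> xs = ys"
proof (induction m arbitrary: n rule: nat_code.induct)
  case (1 m)
  show ?case
  proof (cases "m = 0 \<or> n = 0")
    case True
    then show ?thesis
      using "1.prems" by (auto simp: nat_code.simps[of m] nat_code.simps[of n] split: if_splits)
  next
    case False
    then have "odd m = odd n" and "nat_code (m div 2) @ xs = nat_code (n div 2) @ ys"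
      using "1.prems" by (simp_all add: nat_code.simps[of m] nat_code.simps[of n])
    with "1.IH"[of "n div 2"] False have "m div 2 = n div 2" "odd m = odd n" "xs = ys"
      by auto
    then show ?thesis
      by (metis bit_eq_rec)
  qed
qed

lemma length_nat_code: "n < 2 ^ p \<Longrightarrow> length (nat_code n) \<le> 2 * p + 1"
proof (induction p arbitrary: n)
  case 0
  then show ?case by (simp add: nat_code.simps)
next
  case (Suc p)
  then have "n div 2 < 2 ^ p" by auto
  with Suc.IH[of "n div 2"] show ?case by (subst nat_code.simps) simp
qed

lemma inj_concat_map_nat_code: "inj (\<lambda>ns. concat (map nat_code ns))"
proof (rule injI)
  fix ms ns
  assume "concat (map nat_code ms) = concat (map nat_code ns)"
  then show "ms = ns"
  proof (induction ms arbitrary: ns)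
    case Nil
    then show ?case by (cases ns) auto
  next
    case (Cons m ms)
    then show ?case
      by (cases ns) (auto dest: nat_code_append_cancel)
  qed
qed

section \<open>Naming elements relative to a set known to both ends\<close>

definition rank :: "nat set \<Rightarrow> nat \<Rightarrow> nat" where
  "rank T y = card {t \<in> T. t < y}"

lemma rank_less_card: "finite T \<Longrightarrow> y \<in> T \<Longrightarrow> rank T y < card T"
  unfolding rank_def by (rule psubset_card_mono) auto

lemma inj_on_rank: "finite T \<Longrightarrow> inj_on (rank T) T"
proof (rule linorder_inj_onI)
  fix x y
  assume "finite T" "x < y" "x \<in> T" "y \<in> T"
  then have "rank T x < rank T y"
    unfolding rank_def by (intro psubset_card_mono) auto
  then show "rank T x \<noteq> rank T y" by simp
qed auto

text \<open>The lowest bit separates ranks in \<open>T\<close> from IDs outside \<open>T\<close>. A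
  member of \<open>T\<close> costs only as much as a number below \<open>card T\<close>, however
  long its ID is.\<close>

definition relative_name :: "nat set \<Rightarrow> nat \<Rightarrow> nat" where
  "relative_name T y = (if y \<in> T then 2 * rank T y else 2 * y + 1)"

lemma inj_relative_name:
  assumes "finite T"
  shows "inj (relative_name T)"
proof (rule injI)
  fix x y
  assume eq: "relative_name T x = relative_name T y"
  then have "even (relative_name T x) = even (relative_name T y)" by simp
  then have "x \<in> T \<longleftrightarrow> y \<in> T" by (auto simp: relative_name_def split: if_splits)
  then show "x = y"
    using eq inj_on_rank[OF assms] by (auto simp: relative_name_def inj_on_def split: if_splits)
qed

definition delta :: "nat set \<Rightarrow> nat set \<Rightarrow> bool list" where
  "delta T T' =
     concat (map nat_code (sorted_list_of_set (relative_name T ` ((T - T') \<union> (T' - T)))))"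

text \<open>Decoding is by uniqueness. Finiteness is demanded because
  \<open>sorted_list_of_set\<close> sends every infinite set to the empty list, so an infinite
  \<open>T'\<close> would look like no change.\<close>

definition patch :: "nat set \<Rightarrow> bool list \<Rightarrow> nat set" where
  "patch T b = (THE T'. finite T' \<and> delta T T' = b)"

lemma patch_delta:
  assumes "finite T" "finite T'"
  shows "patch T (delta T T') = T'"
  unfolding patch_def
proof (rule the_equality)
  fix U
  assume U: "finite U \<and> delta T U = delta T T'"
  then have "sorted_list_of_set (relative_name T ` ((T - U) \<union> (U - T))) =
      sorted_list_of_set (relative_name T ` ((T - T') \<union> (T' - T)))"
    using injD[OF inj_concat_map_nat_code] by (simp add: delta_def)
  then have "relative_name T ` ((T - U) \<union> (U - T)) = relative_name T ` ((T - T') \<union> (T' - T))"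
    using U assms by (intro sorted_list_of_set_inject) auto
  then have "(T - U) \<union> (U - T) = (T - T') \<union> (T' - T)"
    using inj_relative_name[OF assms(1)] by (simp add: inj_image_eq_iff)
  then show "U = T'" by blast
qed (use assms in auto)

lemma length_delta:
  assumes fin: "finite T" "finite T'"
    and changes: "card ((T - T') \<union> (T' - T)) \<le> k"
    and lost: "card T \<le> 2 ^ p" and new: "\<And>y. y \<in> T' - T \<Longrightarrow> y < 2 ^ p"
  shows "length (delta T T') \<le> k * (2 * p + 3)"
proof -
  let ?D = "(T - T') \<union> (T' - T)"
  let ?ns = "sorted_list_of_set (relative_name T ` ?D)"
  have "length (nat_code n) \<le> 2 * p + 3" if n: "n \<in> set ?ns" for n
  proof -
    obtain y where y: "y \<in> ?D" "n = relative_name T y" using n fin by auto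
    have "rank T y < 2 ^ p" if "y \<in> T"
      using rank_less_card[OF fin(1) that] lost by simp
    \<comment> \<open>The tag bit of \<open>relative_name\<close> doubles the bound, which gives 2(p
      + 1) + 1 = 2p + 3 bits per name.\<close>
    then have "n < 2 ^ Suc p"
      using y new[of y] by (cases "y \<in> T") (auto simp: relative_name_def)
    from length_nat_code[OF this] show ?thesis by simp
  qed
  then have "sum_list (map (length \<circ> nat_code) ?ns) \<le> sum_list (map (\<lambda>_. 2 * p + 3) ?ns)"
    by (intro sum_list_mono) auto
  then have "length (delta T T') \<le> length ?ns * (2 * p + 3)"
    by (simp add: delta_def length_concat o_def sum_list_triv)
  moreover have "length ?ns \<le> k"
    using changes card_image_le[of ?D "relative_name T"] fin by simp
  ultimately show ?thesis
    by (meson le_trans mult_le_mono1)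
qed

section \<open>Recent neighbours\<close>

text \<open>If \<open>z\<close> was no neighbour before, then \<open>T\<close> is empty, and the
  same formula starts its set with the neighbours that arrive in the same batch as \<open>z\<close>.
  Ties thus count as recent.\<close>

definition update_recent :: "nat set \<Rightarrow> nat set \<Rightarrow> nat set \<Rightarrow> nat \<Rightarrow> nat set" where
  "update_recent N N' T z = (if z \<in> N' then T \<inter> N' \<union> (N' - N) else {})"

primrec recent :: "(nat \<Rightarrow> network) \<Rightarrow> nat \<Rightarrow> nat \<Rightarrow> nat \<Rightarrow> nat set" where
  "recent G 0 u z = (if z \<in> nbrs (G 0) u then nbrs (G 0) u else {})"
| "recent G (Suc i) u z =
     update_recent (nbrs (G i) u) (nbrs (G (Suc i)) u) (recent G i u z) z"

lemma recent_subset_nbrs: "recent G i u z \<subseteq> nbrs (G i) u"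
  by (cases i) (auto simp: update_recent_def)

lemma recent_eq_empty: "z \<notin> nbrs (G i) u \<Longrightarrow> recent G i u z = {}"
  by (cases i) (auto simp: update_recent_def)

lemma pair_graph_nbrs:
  assumes "pair_graph H"
  shows nbrs_subset: "nbrs H v \<subseteq> pverts H"
    and nbrs_empty: "v \<notin> pverts H \<Longrightarrow> nbrs H v = {}"
    and finite_nbrs: "finite (nbrs H v)"
    and nbrs_sym: "u \<in> nbrs H v \<longleftrightarrow> v \<in> nbrs H u"
proof -
  interpret pair_graph H by (rule assms)
  show sub: "nbrs H v \<subseteq> pverts H" for v
    by (auto simp: nbrs_def dest: in_arcsD2)
  show "v \<notin> pverts H \<Longrightarrow> nbrs H v = {}"
    by (auto simp: nbrs_def dest: in_arcsD1)
  show "finite (nbrs H v)"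
    using finite_subset[OF sub pair_finite_verts] .
  show "u \<in> nbrs H v \<longleftrightarrow> v \<in> nbrs H u"
    using pair_sym_arcs by (auto simp: nbrs_def symmetric_def dest: symD)
qed

lemma finite_recent: "pair_graph (G i) \<Longrightarrow> finite (recent G i u z)"
  by (meson finite_nbrs finite_subset recent_subset_nbrs)

lemma batched_network_graph: "batched_network k L r G \<Longrightarrow> i \<le> r \<Longrightarrow> pair_graph (G i)"
  by (simp add: batched_network_def)

lemma batched_network_id:
  "batched_network k L r G \<Longrightarrow> i \<le> r \<Longrightarrow> v \<in> pverts (G i) \<Longrightarrow> v < 2 ^ L (card (pverts (G i)))"
  by (simp add: batched_network_def)

lemma batched_network_batch: "batched_network k L r G \<Longrightarrow> i < r \<Longrightarrow> batch k (G i) (G (Suc i))"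
  by (simp add: batched_network_def)

lemma batch_old_edge:
  "batch k H H' \<Longrightarrow> v \<in> nbrs H' u \<Longrightarrow> u \<in> pverts H \<Longrightarrow> v \<in> pverts H \<Longrightarrow> v \<in> nbrs H u"
  by (auto simp: batch_def nbrs_def)

text \<open>The witness \<open>z\<close> is an oldest node of the clique.\<close>

lemma clique_recent_for_some_node:
  assumes net: "batched_network k L r G"
  shows "i \<le> r \<Longrightarrow> S \<noteq> {} \<Longrightarrow> S \<subseteq> pverts (G i)
    \<Longrightarrow> (\<And>u v. u \<in> S \<Longrightarrow> v \<in> S \<Longrightarrow> u \<noteq> v \<Longrightarrow> v \<in> nbrs (G i) u)
    \<Longrightarrow> \<exists>z \<in> S. \<forall>u \<in> S - {z}. \<forall>v \<in> S - {u}. v \<in> recent G i u z"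
proof (induction i arbitrary: S)
  case 0
  then show ?case by fastforce
next
  case (Suc i)
  let ?old = "S \<inter> pverts (G i)"
  note graph = batched_network_graph[OF net]
  \<comment> \<open>A node outside \<open>G i\<close> has no neighbours there, so every clique edge
    at a new node is new.\<close>
  have new_edge: "v \<in> nbrs (G (Suc i)) u - nbrs (G i) u"
    if "u \<in> S" "v \<in> S" "u \<noteq> v" "u \<notin> ?old \<or> v \<notin> ?old" for u v
    using that Suc.prems(1,4) nbrs_subset[OF graph, of i] nbrs_empty[OF graph, of i] by fastforce
  show ?case
  proof (cases "?old = {}")
    case True
    \<comment> \<open>The whole clique arrives in this batch, so its edges have equal age and any
      node can serve as \<open>z\<close>.\<close>
    obtain z where z: "z \<in> S" using Suc.prems(2) by blast
    have "v \<in> recent G (Suc i) u z" if "u \<in> S - {z}" "v \<in> S - {u}" for u v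
      using that z new_edge[of u v] new_edge[of u z] True by (auto simp: update_recent_def)
    with z show ?thesis by blast
  next
    case False
    \<comment> \<open>Here the restriction on updates enters: no edge is inserted between surviving
      nodes, so these already formed a clique.\<close>
    have "v \<in> nbrs (G i) u" if "u \<in> ?old" "v \<in> ?old" "u \<noteq> v" for u v
      using that Suc.prems(1,4) batch_old_edge[OF batched_network_batch[OF net]] by auto
    with Suc.IH[of ?old] False Suc.prems(1) obtain z where z: "z \<in> ?old"
      and rec: "\<And>u v. u \<in> ?old - {z} \<Longrightarrow> v \<in> ?old - {u} \<Longrightarrow> v \<in> recent G i u z"
      by (metis Suc_leD inf_le2)
    have "v \<in> recent G (Suc i) u z" if uv: "u \<in> S - {z}" "v \<in> S - {u}" for u v
    proof -
      have "z \<in> nbrs (G (Suc i)) u" "v \<in> nbrs (G (Suc i)) u"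
        using uv z Suc.prems(4) by auto
      \<comment> \<open>If \<open>u\<close> and \<open>v\<close> are both old, the induction
        hypothesis applies. Otherwise the edge between them is new in this round, hence not older
        than the edge from \<open>u\<close> to \<open>z\<close>.\<close>
      moreover have "v \<in> recent G i u z \<or> v \<notin> nbrs (G i) u"
        using rec[of u v] new_edge[of u v] uv by blast
      ultimately show ?thesis by (auto simp: update_recent_def)
    qed
    with z show ?thesis by blast
  qed
qed

section \<open>The algorithm\<close>

definition initial_nbrs :: "view \<Rightarrow> nat \<Rightarrow> nat set" where
  "initial_nbrs w v = (case initial_topology w of None \<Rightarrow> {} | Some H \<Rightarrow> nbrs H v)"

lemma initial_nbrs_received [simp]: "initial_nbrs (w\<lparr>received := ms\<rparr>) = initial_nbrs w"
  by (simp add: initial_nbrs_def fun_eq_iff)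

fun latest_nbrs :: "nat set \<Rightarrow> (nat \<rightharpoonup> bool list) list \<Rightarrow> nat set" where
  "latest_nbrs N [] = N"
| "latest_nbrs N (m # ms) = dom m"

fun told :: "nat set \<Rightarrow> (nat \<rightharpoonup> bool list) list \<Rightarrow> nat \<Rightarrow> nat set" where
  "told N [] z = (if z \<in> N then N else {})"
| "told N (m # ms) z = update_recent (latest_nbrs N ms) (dom m) (told N ms z) z"

text \<open>A round without a message from \<open>u\<close> is a round in which \<open>u\<close> is
  no neighbour; resetting to the empty set then matches what \<open>update_recent\<close> does at
  \<open>u\<close>, so both ends keep the same set.\<close>

fun heard :: "(nat \<Rightarrow> nat set) \<Rightarrow> (nat \<rightharpoonup> bool list) list \<Rightarrow> nat \<Rightarrow> nat set" where
  "heard T [] u = T u"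
| "heard T (m # ms) u = (case m u of None \<Rightarrow> {} | Some b \<Rightarrow> patch (heard T ms u) b)"

definition view_nbrs :: "view \<Rightarrow> nat set" where
  "view_nbrs w = latest_nbrs (initial_nbrs w (node_id w)) (received w)"

definition view_told :: "view \<Rightarrow> nat \<Rightarrow> nat set" where
  "view_told w = told (initial_nbrs w (node_id w)) (received w)"

definition view_heard :: "view \<Rightarrow> nat \<Rightarrow> nat set" where
  "view_heard w =
     heard (\<lambda>u. if u \<in> initial_nbrs w (node_id w) then initial_nbrs w u else {}) (received w)"

definition clique_algorithm :: "nat \<Rightarrow> algorithm" where
  "clique_algorithm s =
     \<lparr>send = \<lambda>w N z. delta (view_told w z) (update_recent (view_nbrs w) N (view_told w z) z),
      listing = \<lambda>w. {S. card S = s \<and> node_id w \<in> S \<and>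
        (\<forall>u \<in> S - {node_id w}. \<forall>v \<in> S - {u}. v \<in> view_heard w u)}\<rparr>"

text \<open>The invariant of the algorithm: what a node computes from its view agrees with the sets
  defined from the true history of the network.\<close>

definition faithful :: "(nat \<Rightarrow> network) \<Rightarrow> nat \<Rightarrow> nat \<Rightarrow> view \<Rightarrow> bool" where
  "faithful G i v w \<longleftrightarrow> node_id w = v \<and> view_nbrs w = nbrs (G i) v \<and>
     view_told w = recent G i v \<and> view_heard w = (\<lambda>u. recent G i u v)"

text \<open>A node absent from \<open>G i\<close> has only empty recent sets there, and these are
  what the blank view yields. This covers new nodes, including those that reuse an ID.\<close>

lemma faithful_carry_over:
  assumes "pair_graph (G i)" and "faithful G i v (W v)"
  shows "faithful G i v (carry_over (G i) W v)"
proof (cases "v \<in> pverts (G i)")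
  case True
  with assms(2) show ?thesis by (simp add: carry_over_def)
next
  case False
  then have "nbrs (G i) v = {}" "recent G i v = (\<lambda>u. {})" "(\<lambda>u. recent G i u v) = (\<lambda>u. {})"
    using nbrs_empty[OF assms(1)] nbrs_sym[OF assms(1)] recent_subset_nbrs[of G i v]
      recent_eq_empty[of v G i] by fastforce+
  with False show ?thesis
    by (auto simp: faithful_def carry_over_def view_nbrs_def view_told_def view_heard_def
        initial_nbrs_def)
qed

lemma message_clique_algorithm:
  assumes "faithful G i u (W u)"
  shows "message (clique_algorithm s) (G (Suc i)) W u z =
    delta (recent G i u z) (recent G (Suc i) u z)"
  using assms by (simp add: message_def clique_algorithm_def faithful_def)

text \<open>The sender encodes its change relative to \<open>recent G i u v\<close>, which is
  exactly the set that the receiver holds, so \<open>patch\<close> recovers the new set.\<close>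

lemma faithful_exchange:
  assumes graph: "pair_graph (G i)" "pair_graph (G (Suc i))"
    and W: "\<And>v. faithful G i v (W v)"
  shows "faithful G (Suc i) v (exchange (clique_algorithm s) (G (Suc i)) W v)"
proof -
  let ?w = "exchange (clique_algorithm s) (G (Suc i)) W v"
  let ?m = "\<lambda>u. if u \<in> nbrs (G (Suc i)) v
    then Some (delta (recent G i u v) (recent G (Suc i) u v)) else None"
  have w: "?w = (W v)\<lparr>received := ?m # received (W v)\<rparr>"
    by (simp add: exchange_def message_clique_algorithm[of G i _ W, OF W] cong: if_cong)
  have dom: "dom ?m = nbrs (G (Suc i)) v"
    by (auto split: if_splits)
  have nbrs: "view_nbrs ?w = nbrs (G (Suc i)) v"
    by (simp only: w view_nbrs_def) (simp add: dom)
  have told: "view_told ?w z = recent G (Suc i) v z" for z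
  proof -
    have "view_told ?w z = update_recent (view_nbrs (W v)) (dom ?m) (view_told (W v) z) z"
      by (simp add: w view_told_def view_nbrs_def)
    then show ?thesis
      unfolding dom using W[of v] by (simp add: faithful_def)
  qed
  have heard: "view_heard ?w u = recent G (Suc i) u v" for u
  proof (cases "u \<in> nbrs (G (Suc i)) v")
    case True
    have "view_heard ?w u = patch (view_heard (W v) u) (delta (recent G i u v) (recent G (Suc i) u v))"
      using True by (simp add: w view_heard_def cong: if_cong)
    also have "\<dots> = recent G (Suc i) u v"
      using W[of v] patch_delta[OF finite_recent[of G, OF graph(1)] finite_recent[of G, OF graph(2)]]
      by (simp only: faithful_def)
    finally show ?thesis .
  next
    case False
    then have "recent G (Suc i) u v = {}"
      using nbrs_sym[OF graph(2)] recent_eq_empty by blast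
    with False show ?thesis by (simp add: w view_heard_def)
  qed
  from nbrs told heard W[of v] show ?thesis
    by (auto simp: faithful_def w)
qed

lemma faithful_views:
  assumes net: "batched_network k L r G" and "i \<le> r"
  shows "faithful G i v (views (clique_algorithm s) G i v)"
  using assms(2)
proof (induction i arbitrary: v)
  case 0
  then show ?case
    using nbrs_sym[OF batched_network_graph[OF net, of 0], of v]
    by (auto simp: fun_eq_iff faithful_def view_nbrs_def view_told_def view_heard_def
        initial_nbrs_def)
next
  case (Suc i)
  then show ?case
    using batched_network_graph[OF net] by (auto intro!: faithful_exchange faithful_carry_over)
qed

section \<open>Bandwidth and correctness\<close>

text \<open>The shift by one keeps the logarithm nonnegative, also at \<open>n = 0\<close>.\<close>

definition bit_length :: "nat \<Rightarrow> nat" where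
  "bit_length n = nat \<lceil>log 2 (real n + 1)\<rceil>"

lemma le_two_power_bit_length: "n \<le> 2 ^ bit_length n"
proof -
  have "log 2 (real n + 1) \<le> real (bit_length n)"
    unfolding bit_length_def by linarith
  then have "real n + 1 \<le> 2 ^ bit_length n"
    by (simp add: log_le_iff powr_realpow)
  then show ?thesis
    by (metis of_nat_le_iff of_nat_numeral of_nat_power le_add_same_cancel1 order.trans zero_le_one)
qed

lemma clique_algorithm_bandwidth:
  assumes net: "batched_network k L r G"
  shows "within_bandwidth (clique_algorithm s) (\<lambda>n. k * (2 * (L n + bit_length (n + k)) + 3)) r G"
  unfolding within_bandwidth_def
proof (intro allI impI ballI, clarify)
  fix i u v
  assume i: "i < r" and uv: "(u, v) \<in> parcs (G (Suc i))"
  let ?W = "carry_over (G i) (views (clique_algorithm s) G i)"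
  let ?n = "card (pverts (G (Suc i)))"
  \<comment> \<open>The first summand bounds the IDs of gained neighbours, the second the ranks of
    lost ones.\<close>
  let ?p = "L ?n + bit_length (?n + k)"
  let ?T = "recent G i u v" and ?T' = "recent G (Suc i) u v"
  let ?N = "nbrs (G i) u" and ?N' = "nbrs (G (Suc i)) u"
  have graph: "pair_graph (G i)" "pair_graph (G (Suc i))"
    using batched_network_graph[OF net] i by auto
  have v: "v \<in> ?N'" using uv by (simp add: nbrs_def)
  then have u: "u \<in> pverts (G (Suc i))" using nbrs_empty[OF graph(2), of u] by blast
  have fin: "finite ?N" "finite ?N'" using graph finite_nbrs by auto
  have changes: "card (?N' - ?N) + card (?N - ?N') \<le> k"
    using batched_network_batch[OF net i] u by (auto simp: batch_def)
  have "card ?N' \<le> ?n"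
    using nbrs_subset[OF graph(2)] graph(2)
    by (simp add: card_mono pair_fin_digraph.pair_finite_verts pair_graph.axioms pair_digraph.axioms)
  \<comment> \<open>The batch removes at most \<open>k\<close> neighbours of \<open>u\<close>, so
    the old set is bounded by the current number of nodes plus \<open>k\<close>.\<close>
  moreover have "card ?N \<le> card ?N' + card (?N - ?N')"
    by (metis card_Un_le card_mono fin finite_Un le_trans Un_Diff_cancel Un_upper2)
  moreover have "card ?T \<le> card ?N"
    using fin(1) recent_subset_nbrs by (rule card_mono)
  ultimately have "card ?T \<le> ?n + k" using changes by linarith
  also have "\<dots> \<le> 2 ^ bit_length (?n + k)" by (rule le_two_power_bit_length)
  also have "\<dots> \<le> 2 ^ ?p" by simp
  finally have lost: "card ?T \<le> 2 ^ ?p" .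
  have new: "y < 2 ^ ?p" if "y \<in> ?T' - ?T" for y
  proof -
    have "y \<in> pverts (G (Suc i))"
      using that recent_subset_nbrs nbrs_subset[OF graph(2)] by blast
    then have "y < 2 ^ L ?n" using batched_network_id[OF net] i by auto
    also have "(2::nat) ^ L ?n \<le> 2 ^ ?p" by simp
    finally show ?thesis .
  qed
  \<comment> \<open>As \<open>v\<close> is still or newly a neighbour, the set is not cleared and
    changes only where the neighbour list of \<open>u\<close> does.\<close>
  have "(?T - ?T') \<union> (?T' - ?T) \<subseteq> (?N' - ?N) \<union> (?N - ?N')"
    using v recent_subset_nbrs[of G i u v] by (auto simp: update_recent_def)
  then have "card ((?T - ?T') \<union> (?T' - ?T)) \<le> card ((?N' - ?N) \<union> (?N - ?N'))"
    using fin by (intro card_mono) auto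
  also have "\<dots> \<le> k" using changes card_Un_le le_trans by blast
  finally have "length (delta ?T ?T') \<le> k * (2 * ?p + 3)"
    by (rule length_delta[OF finite_recent[of G, OF graph(1)] finite_recent[of G, OF graph(2)] _ lost new])
  moreover have "faithful G i u (?W u)"
    using faithful_carry_over[of G, OF graph(1)] faithful_views[OF net] i by simp
  ultimately show "length (message (clique_algorithm s) (G (Suc i)) ?W u v) \<le> k * (2 * ?p + 3)"
    by (simp only: message_clique_algorithm)
qed

lemma clique_algorithm_correct:
  assumes net: "batched_network k L r G" and s: "s \<ge> 1"
    and K: "complete_digraph s (with_proj K)"
  shows "lists_correctly (clique_algorithm s) K r G"
  unfolding lists_correctly_def
proof (intro allI impI conjI ballI subsetI)
  fix i S
  assume i: "1 \<le> i \<and> i \<le> r" and "S \<in> copies K (G i)"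
  then have S: "S \<subseteq> pverts (G i)" "card S = s"
    and clique: "\<And>u v. u \<in> S \<Longrightarrow> v \<in> S \<Longrightarrow> u \<noteq> v \<Longrightarrow> v \<in> nbrs (G i) u"
    using copies_complete[OF K batched_network_graph[OF net]] by (auto simp: nbrs_def)
  \<comment> \<open>With \<open>s \<ge> 1\<close> a copy has a node that can list it.\<close>
  from S(2) s have "S \<noteq> {}" by auto
  with S(1) clique i have "\<exists>z \<in> S. \<forall>u \<in> S - {z}. \<forall>v \<in> S - {u}. v \<in> recent G i u z"
    by (intro clique_recent_for_some_node[OF net]) simp_all
  then obtain z where "z \<in> S" "\<forall>u \<in> S - {z}. \<forall>v \<in> S - {u}. v \<in> recent G i u z"
    by blast
  with S(2) faithful_views[OF net, of i z s] i
  show "\<exists>v \<in> S. S \<in> listing (clique_algorithm s) (views (clique_algorithm s) G i v)"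
    by (intro bexI[of _ z]) (auto simp: faithful_def clique_algorithm_def)
next
  fix i v S
  assume i: "1 \<le> i \<and> i \<le> r" and v: "v \<in> pverts (G i)"
    and "S \<in> listing (clique_algorithm s) (views (clique_algorithm s) G i v)"
  with faithful_views[OF net, of i v s] have S: "card S = s" "v \<in> S"
    and heard: "\<And>x y. x \<in> S - {v} \<Longrightarrow> y \<in> S - {x} \<Longrightarrow> y \<in> recent G i x v"
    by (auto simp: faithful_def clique_algorithm_def)
  have graph: "pair_graph (G i)" using batched_network_graph[OF net] i by blast
  \<comment> \<open>Recent sets consist of current neighbours. Edges starting at \<open>v\<close>
    itself are obtained by symmetry from the sets heard from their other ends.\<close>
  have clique: "y \<in> nbrs (G i) x" if "x \<in> S" "y \<in> S" "x \<noteq> y" for x y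
    using that heard recent_subset_nbrs[of G i] nbrs_sym[OF graph, of x y]
    by (cases "x = v") blast+
  then have "S \<subseteq> pverts (G i)" using nbrs_subset[OF graph, of v] v S(2) by blast
  with clique S(1) show "S \<in> copies K (G i)"
    using copies_complete[OF K graph] by (auto simp: nbrs_def)
qed

section \<open>Asymptotics of the bandwidth\<close>

lemma bit_length_bigo: "(\<lambda>n. real (bit_length (n + k))) \<in> O(\<lambda>n. ln (real n))"
proof -
  have "(\<lambda>n. real (bit_length (n + k))) \<in> O(\<lambda>n. log 2 (real n + real k + 1) + 1)"
  proof (intro bigoI[of _ 1] always_eventually allI)
    fix n
    have "0 \<le> log 2 (real n + real k + 1)" by simp
    then have "real (bit_length (n + k)) \<le> log 2 (real n + real k + 1) + 1"
      unfolding bit_length_def by simp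
    then show "norm (real (bit_length (n + k))) \<le> 1 * norm (log 2 (real n + real k + 1) + 1)"
      by simp
  qed
  also have "(\<lambda>n. log 2 (real n + real k + 1) + 1) \<in> O(\<lambda>n. ln (real n))"
    by real_asymp
  finally show ?thesis .
qed

theorem theorem4:
  fixes s k :: nat and K :: "'k pair_pre_digraph" and L :: "nat \<Rightarrow> nat"
  assumes "s \<ge> 1" and "complete_digraph s (with_proj K)"
    and "(\<lambda>n. real (L n)) \<in> O(\<lambda>n. ln (real n))"
  shows "\<exists>B :: nat \<Rightarrow> nat. (\<lambda>n. real (B n)) \<in> O(\<lambda>n. ln (real n)) \<and>
           batched_list_one_round K k L B"
proof (intro exI conjI)
  let ?B = "\<lambda>n. k * (2 * (L n + bit_length (n + k)) + 3)"
  have const: "(\<lambda>_. 3 :: real) \<in> O(\<lambda>n. ln (real n))"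
    by real_asymp
  have "(\<lambda>n. real k * (2 * (real (L n) + real (bit_length (n + k))) + 3)) \<in> O(\<lambda>n. ln (real n))"
  proof -
    have "(\<lambda>n. 2 * (real (L n) + real (bit_length (n + k))) + 3) \<in> O(\<lambda>n. ln (real n))"
      using assms(3) bit_length_bigo[of k] const by (simp add: sum_in_bigo)
    then show ?thesis by simp
  qed
  then show "(\<lambda>n. real (?B n)) \<in> O(\<lambda>n. ln (real n))"
    by simp
  show "batched_list_one_round K k L ?B"
    unfolding batched_list_one_round_def
    using clique_algorithm_bandwidth clique_algorithm_correct assms(1,2) by blast
qed

end
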